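(* For every integer $X \geq 7$, one has $T(X) = T(7)$, where for a positive integer $X$ $$T(X) = \left(\bigcup_{x=1}^{X} \left\{10^x - y^2 \mid y \in \mathbb{Z}\right\}\right) \cap [0,2000].$$
   Context: The index $x$ ranges over the integers $1,\dots,X$, and $T(X)$ is a set of integers in the closed interval $[0,2000]$. *)

theory Defs
  imports Complex_Main
begin

definition T :: "nat \<Rightarrow> int set" where
  "T X = (\<Union>x\<in>{1..X}. {10 ^ x - y\<^sup>2 | y :: int. True}) \<inter> {0..2000}"

end

theory Submission
  imports Defs
begin

text \<open>
  Only exponents \<open>x \<ge> 8\<close> need attention: a value \<open>n = 10\<^sup>x - y\<^sup>2\<close> in \<open>[0,2000]\<close> must be shown
  to arise already from an exponent at most 7.

  If \<open>x\<close> is even, \<open>10\<^sup>x\<close> is the square of some \<open>b \<ge> 10\<^sup>4\<close>. The next smaller square differs from it by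
  \<open>2b - 1 > 2000\<close>, so \<open>n = 0\<close>, which is \<open>10\<^sup>2 - 10\<^sup>2\<close> (\<open>even_exponent_value_eq_0\<close>).

  If \<open>x\<close> is odd, then \<open>x \<ge> 9\<close>, and a size estimate would need a bound on how well \<open>\<surd>10\<close> is
  approximated by decimal fractions. Since only 2001 values of \<open>n\<close> are in question, congruences
  can replace it: for each \<open>n\<close>, the number \<open>10\<^sup>x - n\<close> has to be a square modulo every
  \<open>m\<close>. If \<open>m\<close> is a power of 2 or 5 with exponent at most 9, then \<open>10\<^sup>x\<close> vanishes modulo \<open>m\<close>; if \<open>m\<close> is
  another prime, \<open>10\<^sup>x\<close> depends only on the class of \<open>x\<close> modulo the order of 10. Moduli whose periods
  divide 336 are enough to exclude every \<open>n\<close> in each odd class of exponents, apart from the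
  values \<open>10\<^sup>z - y\<^sup>2\<close> with \<open>z\<close> one of 3, 5, 7. These have to be set aside, since in the class of \<open>z\<close> they pass
  at every prime other than 2 and 5; but they lie in \<open>T 7\<close> (\<open>small_values_subset_T\<close>). The exclusion
  is a finite computation (\<open>candidates_eliminated\<close>), and \<open>not_mem_if_eliminated\<close> is its soundness.
\<close>

section \<open>Sieving by quadratic residues\<close>

text \<open>The residues of \<open>y\<close> and \<open>m - y\<close> have the same square, so half of the range suffices.\<close>

definition square_residues :: "int \<Rightarrow> int list" where
  "square_residues m = map (\<lambda>y. y\<^sup>2 mod m) [0..m div 2]"

fun sift :: "int \<Rightarrow> int list \<Rightarrow> int \<Rightarrow> int list \<Rightarrow> int list" where
  "sift m qs c [] = []"
| "sift m qs c (n # ns) =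
     (if (c - n) mod m \<in> set qs then n # sift m qs c ns else sift m qs c ns)"

lemma set_sift: "set (sift m qs c ns) = {n \<in> set ns. (c - n) mod m \<in> set qs}"
  by (induction ns) auto

fun power_10_mod :: "int \<Rightarrow> nat \<Rightarrow> int" where
  "power_10_mod m 0 = 1"
| "power_10_mod m (Suc k) = (10 * power_10_mod m k) mod m"

text \<open>
  Explicit recursion over the list, here and in \<^const>\<open>sift\<close>, keeps symbolic evaluation from expanding
  the tests for a symbolic argument under an abstraction. The test for the empty list spares the
  square residues of a large modulus once no candidate is left.
\<close>

fun sieve :: "int list \<Rightarrow> nat \<Rightarrow> int list \<Rightarrow> int list" where
  "sieve [] k ns = ns"
| "sieve (m # ms) k ns =
     (if ns = [] then []
      else sieve ms k (sift m (square_residues m) (power_10_mod m k) ns))"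

lemma power_10_mod: "power_10_mod m k mod m = 10 ^ k mod m"
proof (induction k)
  case (Suc k)
  have "power_10_mod m (Suc k) mod m = 10 * (power_10_mod m k mod m) mod m"
    by (simp add: mod_mult_right_eq)
  then show ?case by (simp add: Suc.IH mod_mult_right_eq)
qed simp

lemma square_mod_in_square_residues:
  assumes "m > 0"
  shows "y\<^sup>2 mod m \<in> set (square_residues m)"
proof -
  define z where "z = y mod m"
  have z: "0 \<le> z" "z < m" and sq: "y\<^sup>2 mod m = z\<^sup>2 mod m"
    using assms by (simp_all add: z_def power_mod)
  show ?thesis
  proof (cases "z \<le> m div 2")
    case True
    then show ?thesis using z sq by (auto simp: square_residues_def)
  next
    case False
    have "(m - z)\<^sup>2 = z\<^sup>2 + (m - 2 * z) * m"
      by (simp add: power2_eq_square algebra_simps)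
    then have "z\<^sup>2 mod m = (m - z)\<^sup>2 mod m"
      by simp
    moreover have "m - z \<in> set [0..m div 2]"
      using False z by auto
    ultimately show ?thesis
      using sq by (auto simp: square_residues_def)
  qed
qed

lemma mem_sieve:
  assumes "n \<in> set ns"
    and "\<And>m. m \<in> set ms \<Longrightarrow> m > 0 \<and> (10 ^ k - n) mod m = y\<^sup>2 mod m"
  shows "n \<in> set (sieve ms k ns)"
  using assms
proof (induction ms arbitrary: ns)
  case Nil
  then show ?case by simp
next
  case (Cons m ms)
  have m: "(10 ^ k - n) mod m = y\<^sup>2 mod m" "m > 0"
    using Cons.prems(2)[of m] by simp_all
  have "(power_10_mod m k - n) mod m = (10 ^ k - n) mod m"
    using power_10_mod by (rule mod_diff_cong) simp
  then have "n \<in> set (sift m (square_residues m) (power_10_mod m k) ns)"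
    using Cons.prems(1) square_mod_in_square_residues[of m y] m by (simp add: set_sift)
  from Cons.IH[OF this] show ?case
    using Cons.prems by auto
qed

section \<open>Refining the classes of exponents\<close>

text \<open>
  With all moduli in use at once, the exponents would have to be split into as many
  classes as the longest period requires, and each candidate would be tested in each class. Most
  candidates already fail for moduli of short period, so the class of \<open>k\<close> modulo \<open>P\<close> is split into
  \<open>t\<close> classes modulo \<open>P * t\<close> only while candidates remain.
\<close>

fun eliminated :: "(nat \<times> int list) list \<Rightarrow> nat \<Rightarrow> nat \<Rightarrow> int list \<Rightarrow> bool"
and eliminated_classes ::
  "(nat \<times> int list) list \<Rightarrow> nat \<Rightarrow> int list \<Rightarrow> nat list \<Rightarrow> int list \<Rightarrow> bool" where
  "eliminated [] P k ns \<longleftrightarrow> ns = []"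
| "eliminated ((t, ms) # ls) P k ns \<longleftrightarrow>
     (if ns = [] then True
      else eliminated_classes ls (P * t) ms (map (\<lambda>i. k + i * P) [0..<t]) ns)"
| "eliminated_classes ls P ms [] ns \<longleftrightarrow> True"
| "eliminated_classes ls P ms (k # ks) ns \<longleftrightarrow>
     (if eliminated ls P k (sieve ms k ns) then eliminated_classes ls P ms ks ns else False)"

lemma eliminated_classes_iff:
  "eliminated_classes ls P ms ks ns \<longleftrightarrow> (\<forall>k\<in>set ks. eliminated ls P k (sieve ms k ns))"
  by (induction ks) auto

text \<open>The factor \<open>10\<^sup>9\<close> admits powers of 2 and 5 as moduli; all exponents are at least 9.\<close>

fun moduli_periodic :: "nat \<Rightarrow> (nat \<times> int list) list \<Rightarrow> bool" where
  "moduli_periodic P [] = True"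
| "moduli_periodic P ((t, ms) # ls) =
     (t > 0 \<and> (\<forall>m\<in>set ms. m > 0 \<and> m dvd 10 ^ 9 * (10 ^ (P * t) - 1)) \<and> moduli_periodic (P * t) ls)"

lemma power_mod_periodic:
  fixes m :: int
  assumes "m dvd 10 ^ 9 * (10 ^ P - 1)" "9 \<le> k" "k \<le> x" "P dvd x - k"
  shows "10 ^ x mod m = 10 ^ k mod m"
proof -
  obtain s where s: "x - k = P * s" using assms(4) by auto
  have "(10::int) ^ P - 1 dvd (10 ^ P) ^ s - 1"
    by (simp add: power_diff_1_eq)
  then have "10 ^ 9 * (10 ^ P - 1) dvd 10 ^ k * ((10::int) ^ (x - k) - 1)"
    using assms(2) s by (intro mult_dvd_mono le_imp_power_dvd) (simp_all add: power_mult)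
  also have "10 ^ k * ((10::int) ^ (x - k) - 1) = 10 ^ x - 10 ^ k"
    using assms(3) by (simp add: algebra_simps flip: power_add)
  finally show ?thesis
    using assms(1) by (meson dvd_trans mod_eq_dvd_iff)
qed

lemma mem_sieve_power:
  assumes "n \<in> set ns" "n = 10 ^ x - y\<^sup>2" "9 \<le> k" "k \<le> x" "P dvd x - k"
    and "\<forall>m\<in>set ms. m > 0 \<and> m dvd 10 ^ 9 * (10 ^ P - 1)"
  shows "n \<in> set (sieve ms k ns)"
proof (rule mem_sieve[OF assms(1)])
  fix m assume "m \<in> set ms"
  with assms(6) have m: "m > 0" "m dvd 10 ^ 9 * (10 ^ P - 1)" by auto
  have "(10 ^ k - n) mod m = (10 ^ x - n) mod m"
    using power_mod_periodic[OF m(2) assms(3-5)] by (intro mod_diff_cong) simp_all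
  with m show "m > 0 \<and> (10 ^ k - n) mod m = y\<^sup>2 mod m"
    by (simp add: assms(2))
qed

lemma not_mem_if_eliminated:
  assumes "eliminated ls P k ns" "moduli_periodic P ls" "P > 0"
    and "n = 10 ^ x - y\<^sup>2" "9 \<le> k" "k \<le> x" "P dvd x - k"
  shows "n \<notin> set ns"
  using assms
proof (induction ls arbitrary: P k ns)
  case Nil
  then show ?case by simp
next
  case (Cons l ls)
  obtain t ms where l: "l = (t, ms)" by (cases l)
  show ?case
  proof
    assume n: "n \<in> set ns"
    obtain s where s: "x - k = P * s" using Cons.prems(7) by auto
    \<comment> \<open>the class modulo \<open>P * t\<close> that contains \<open>x\<close>\<close>
    define i where "i = s mod t"
    have "t > 0" using Cons.prems(2) l by simp
    then have "i < t" by (simp add: i_def)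
    have "s = t * (s div t) + i" by (simp add: i_def)
    then have "P * s = P * t * (s div t) + i * P"
      by (metis distrib_left mult.assoc mult.commute)
    then have x: "x = k + i * P + P * t * (s div t)"
      using s Cons.prems(6) by linarith
    then have k': "9 \<le> k + i * P" "k + i * P \<le> x" "P * t dvd x - (k + i * P)"
      using Cons.prems(5) by auto
    let ?ns = "sieve ms (k + i * P) ns"
    have "n \<in> set ?ns"
      using mem_sieve_power[OF n Cons.prems(4) k'] Cons.prems(2) l by simp
    moreover have "eliminated ls (P * t) (k + i * P) ?ns"
      using Cons.prems(1) \<open>i < t\<close> n l
      by (auto simp: eliminated_classes_iff split: if_splits)
    then have "n \<notin> set ?ns"
      using Cons.IH[OF _ _ _ Cons.prems(4) k'] Cons.prems(2,3) l \<open>t > 0\<close> by simp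
    ultimately show False by simp
  qed
qed

section \<open>The computation\<close>

text \<open>
  All pairs with \<open>x\<close> one of 3, 5, 7 and \<open>y \<ge> 0\<close> for which \<open>10\<^sup>x - y\<^sup>2\<close> lies in \<open>[0,2000]\<close>. The exponent 1
  is left out because its values 1, 6, 9, 10 fail modulo 8.
\<close>

definition small_value_pairs :: "(nat \<times> int) list" where
  "small_value_pairs = map (Pair 3) [0..31] @ map (Pair 5) [314..316] @ [(7, 3162)]"

definition small_values :: "int list" where
  "small_values = map (\<lambda>(x, y). 10 ^ x - y\<^sup>2) small_value_pairs"

text \<open>
  Short periods come first, because each further level multiplies the number of exponent classes. The
  resulting periods \<open>P\<close> are 2, 6, 12, 24, 168, 336. The levels after the first consist of prime factors
  of \<open>10\<^sup>P - 1\<close>. The last level is there only for \<open>n = 1231\<close> and exponents \<open>x\<close> congruent to 21 modulo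
  168. The period 60 would also do, with the prime 2161 among the moduli, but the list of its square
  residues is long and costly to compute.
\<close>

definition refinement_levels :: "(nat \<times> int list) list" where
  "refinement_levels =
     [(1, [125, 256]), (3, [7, 13, 37]), (2, [101]), (2, [73, 137]), (7, [29, 43, 127, 239, 281]),
      (2, [17, 113])]"

lemma refinement_levels_periodic: "moduli_periodic 2 refinement_levels"
  by (simp add: refinement_levels_def)

text \<open>
  All odd powers of 10 from \<open>10\<^sup>9\<close> onwards are congruent modulo each of 8, 5, 3, 11. The interval
  \<open>[0,2000]\<close> is cut into short pieces since the cost of symbolic evaluation grows quadratically with the
  length of a list; as \<open>2001 = 29 * 69\<close>, 29 pieces of length 69 fit exactly.
\<close>

fun initial_sieve :: "int list \<Rightarrow> int list" where
  "initial_sieve [] = []"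
| "initial_sieve (b # bs) = sieve [8, 5, 3, 11] 9 [69 * b..69 * b + 68] @ initial_sieve bs"

lemma set_initial_sieve:
  "set (initial_sieve bs) = (\<Union>b\<in>set bs. set (sieve [8, 5, 3, 11] 9 [69 * b..69 * b + 68]))"
  by (induction bs) simp_all

definition candidates :: "int list" where
  "candidates = filter (\<lambda>n. n \<notin> set small_values) (initial_sieve [0..28])"

lemma candidates_eliminated: "eliminated refinement_levels 2 9 candidates"
  by code_simp

lemma small_values_subset_T: "set small_values \<subseteq> T 7"
proof -
  have "list_all (\<lambda>(x, y). 1 \<le> x \<and> x \<le> 7 \<and> 0 \<le> 10 ^ x - y\<^sup>2 \<and> 10 ^ x - y\<^sup>2 \<le> 2000) small_value_pairs"
    by code_simp
  then show ?thesis
    unfolding small_values_def T_def list_all_iff by fastforce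
qed

section \<open>Large exponents\<close>

lemma even_exponent_value_eq_0:
  fixes x :: nat and y :: int
  assumes "even x" "x \<ge> 8" "0 \<le> 10 ^ x - y\<^sup>2" "10 ^ x - y\<^sup>2 \<le> 2000"
  shows "10 ^ x - y\<^sup>2 = 0"
proof -
  define b :: int where "b = 10 ^ (x div 2)"
  have x: "10 ^ x = b\<^sup>2"
    using assms(1) by (auto simp: b_def simp flip: power_mult)
  have "(10::int) ^ 4 \<le> b"
    unfolding b_def using assms(2) by (intro power_increasing) auto
  then have b: "b \<ge> 10000" by simp
  have "\<bar>y\<bar> \<le> b"
    by (rule power2_le_imp_le) (use assms(3) x b in simp_all)
  moreover have "\<not> \<bar>y\<bar> \<le> b - 1"
  proof
    assume "\<bar>y\<bar> \<le> b - 1"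
    then have "\<bar>y\<bar>\<^sup>2 \<le> (b - 1)\<^sup>2"
      by (intro power_mono) auto
    then have "2 * b - 1 \<le> b\<^sup>2 - y\<^sup>2"
      by (simp add: power2_eq_square algebra_simps)
    then show False using assms(4) x b by simp
  qed
  ultimately have "\<bar>y\<bar> = b" by simp
  then have "y\<^sup>2 = b\<^sup>2" by (metis power2_abs)
  with x show ?thesis by simp
qed

lemma odd_exponent_value_small:
  fixes x :: nat and y :: int
  assumes "odd x" "x \<ge> 9" "0 \<le> 10 ^ x - y\<^sup>2" "10 ^ x - y\<^sup>2 \<le> 2000"
  shows "10 ^ x - y\<^sup>2 \<in> set small_values"
proof (rule ccontr)
  define n where "n = 10 ^ x - y\<^sup>2"
  assume "10 ^ x - y\<^sup>2 \<notin> set small_values"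
  have even: "2 dvd x - 9" using assms(1,2) by simp
  have "n \<in> set (sieve [8, 5, 3, 11] 9 [69 * (n div 69)..69 * (n div 69) + 68])"
  proof (rule mem_sieve_power[OF _ n_def order_refl assms(2) even])
    show "n \<in> set [69 * (n div 69)..69 * (n div 69) + 68]"
      unfolding set_upto atLeastAtMost_iff by linarith
    show "\<forall>m\<in>set [8::int, 5, 3, 11]. m > 0 \<and> m dvd 10 ^ 9 * (10 ^ 2 - 1)" by simp
  qed
  moreover have "n div 69 \<in> set [0..28]"
    using assms(3,4) unfolding n_def set_upto atLeastAtMost_iff by linarith
  ultimately have "n \<in> set candidates"
    using \<open>10 ^ x - y\<^sup>2 \<notin> set small_values\<close>
    unfolding candidates_def n_def[symmetric] set_filter set_initial_sieve by blast
  moreover have "n \<notin> set candidates"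
    using not_mem_if_eliminated[OF candidates_eliminated refinement_levels_periodic _ n_def
        order_refl assms(2) even]
    by simp
  ultimately show False by simp
qed

theorem mainTheorem1:
  fixes X :: nat
  assumes "X \<ge> 7"
  shows "T X = T 7"
proof
  show "T 7 \<subseteq> T X"
    unfolding T_def using assms by (intro Int_mono UN_mono) auto
next
  show "T X \<subseteq> T 7"
  proof
    fix n assume "n \<in> T X"
    then obtain x y where x: "x \<in> {1..X}" and n: "n = 10 ^ x - y\<^sup>2" and range: "0 \<le> n" "n \<le> 2000"
      by (auto simp: T_def)
    consider "x \<le> 7" | "even x" "x \<ge> 8" | "odd x" "x \<ge> 9"
      by (cases "even x"; cases "x = 8") force+
    then show "n \<in> T 7"
    proof cases
      case 1
      then show ?thesis using x n range by (auto simp: T_def)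
    next
      case 2
      then have "n = 0" using even_exponent_value_eq_0 n range by blast
      moreover have "\<exists>x\<in>{1..7}. \<exists>y::int. 0 = 10 ^ x - y\<^sup>2"
        by (rule bexI[of _ 2], rule exI[of _ 10]) auto
      ultimately show ?thesis by (auto simp: T_def)
    next
      case 3
      then have "n \<in> set small_values" using odd_exponent_value_small n range by blast
      then show ?thesis using small_values_subset_T by blast
    qed
  qed
qed

end
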